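(* Let $k\in\mathbb{N}$, let $(X,f_{1,\infty})$ be a $k$-periodic non-autonomous discrete system and let $g=f_k\circ f_{k-1}\circ\cdots\circ f_1$. If the autonomous discrete system $(X,g)$ is Li-Yorke sensitive, then $(X,f_{1,\infty})$ is Li-Yorke sensitive. Conversely, if each $f_p$ $(p=1,2,\dots,k)$ is uniformly continuous and $(X,f_{1,\infty})$ is Li-Yorke sensitive, then $(X,g)$ is Li-Yorke sensitive.
   Context: $\mathbb{N}=\{1,2,3,\dots\}$. A non-autonomous discrete system (NDS) $(X,f_{1,\infty})$ consists of a metric space $(X,d)$ and a sequence $f_{1,\infty}=(f_n)_{n=1}^\infty$ of continuous maps $f_n:X\to X$. For $i,n\in\mathbb{N}$, $f_i^n:=f_{i+n-1}\circ\cdots\circ f_i$. The NDS is $k$-periodic if $f_{n+k}=f_n$ for all $n\in\mathbb{N}$. An autonomous system $(X,g)$ is the special case $f_n=g$ for all $n$ (so $f_1^n$ is the $n$-th iterate $g^n$). Li-Yorke sensitive: there is $\delta>0$ such that for any $x\in X$ and any $\varepsilon>0$ there is $y\in B(x,\varepsilon)$ with $\liminf_{n\to\infty}d(f_1^n(x),f_1^n(y))=0$ and $\limsup_{n\to\infty}d(f_1^n(x),f_1^n(y))\ge\delta$. *)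

theory Defs
  imports "HOL-Analysis.Analysis"
begin

(* The sequence f_1, f_2, ... is a function on nat of which only the values at
   indices n >= 1 matter; f 0 is an irrelevant dummy value. *)

definition nds :: "(nat \<Rightarrow> 'a::metric_space \<Rightarrow> 'a) \<Rightarrow> bool" where
  "nds f \<longleftrightarrow> (\<forall>n\<ge>1. continuous_on UNIV (f n))"

definition periodic_nds :: "nat \<Rightarrow> (nat \<Rightarrow> 'a::metric_space \<Rightarrow> 'a) \<Rightarrow> bool" where
  "periodic_nds k f \<longleftrightarrow> nds f \<and> (\<forall>n\<ge>1. f (n + k) = f n)"

(* nds_iter f i n = f (i + n - 1) o ... o f i *)
primrec nds_iter :: "(nat \<Rightarrow> 'a \<Rightarrow> 'a) \<Rightarrow> nat \<Rightarrow> nat \<Rightarrow> 'a \<Rightarrow> 'a" where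
  "nds_iter f i 0 = id"
| "nds_iter f i (Suc n) = f (i + n) \<circ> nds_iter f i n"

definition autonomous :: "('a \<Rightarrow> 'a) \<Rightarrow> nat \<Rightarrow> 'a \<Rightarrow> 'a" where
  "autonomous g = (\<lambda>n. g)"

lemma nds_iter_autonomous: "nds_iter (autonomous g) i n = g ^^ n"
  by (induction n) (simp_all add: autonomous_def)

(* The space may be unbounded, so the upper limit is taken in the extended
   reals, where it always exists and may be infinite. *)
definition Li_Yorke_sensitive :: "(nat \<Rightarrow> 'a::metric_space \<Rightarrow> 'a) \<Rightarrow> bool" where
  "Li_Yorke_sensitive f \<longleftrightarrow>
     (\<exists>\<delta>>0. \<forall>x. \<forall>\<epsilon>>0. \<exists>y\<in>ball x \<epsilon>.
        liminf (\<lambda>n. ereal (dist (nds_iter f 1 n x) (nds_iter f 1 n y))) = 0 \<and>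
        limsup (\<lambda>n. ereal (dist (nds_iter f 1 n x) (nds_iter f 1 n y))) \<ge> ereal \<delta>)"

end

theory Submission
  imports Defs
begin

text \<open>
  The orbit of \<open>g\<close> consists of the terms of the orbit of \<open>f\<close> whose index is a multiple of \<open>k\<close>, so
  passing from \<open>g\<close> to \<open>f\<close> can only lower the lower limit and raise the upper limit of the distances.
  Conversely, a periodic family of uniformly continuous maps is uniformly equicontinuous, and so
  are its compositions of length at most \<open>k\<close>.  Every time is at most \<open>k\<close> steps away from the next
  and from the previous multiple of \<open>k\<close>: if the distances along \<open>g\<close> stay away from 0, so do those
  along \<open>f\<close>, and if the distances along \<open>g\<close> are eventually small, so are those along \<open>f\<close>.
\<close>

lemma nds_iter_add: "nds_iter f i (m + n) = nds_iter f (i + m) n \<circ> nds_iter f i m"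
  by (induction n) (simp_all add: add.assoc comp_assoc)

lemma periodic_nds_add_mult:
  assumes "periodic_nds k f" "i \<ge> 1"
  shows "f (i + m * k) = f i"
proof (induction m)
  case (Suc m)
  have "f ((i + m * k) + k) = f (i + m * k)"
    using assms unfolding periodic_nds_def by simp
  with Suc show ?case by (simp add: ac_simps)
qed simp

lemma nds_iter_periodic_shift:
  assumes "periodic_nds k f" "i \<ge> 1"
  shows "nds_iter f (i + m * k) n = nds_iter f i n"
proof (induction n)
  case (Suc n)
  have "f (i + n + m * k) = f (i + n)"
    using assms periodic_nds_add_mult by (metis trans_le_add1)
  with Suc show ?case by (simp add: ac_simps)
qed simp

text \<open>The \<open>m * k\<close> steps split into \<open>m\<close> blocks of length
  \<open>k\<close>. By periodicity each block acts like the first one.\<close>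

lemma nds_iter_period_mult:
  assumes "periodic_nds k f"
  shows "nds_iter f 1 (m * k) = nds_iter f 1 k ^^ m"
proof (induction m)
  case (Suc m)
  have "nds_iter f 1 (m * k + k) = nds_iter f (1 + m * k) k \<circ> nds_iter f 1 (m * k)"
    by (rule nds_iter_add)
  also have "\<dots> = nds_iter f 1 k \<circ> (nds_iter f 1 k ^^ m)"
    using nds_iter_periodic_shift[OF assms, of 1 m k] Suc by simp
  finally show ?case by (simp add: add.commute)
qed simp

text \<open>Only finitely many different maps occur, so the least of their moduli of continuity
  serves all of them.\<close>

lemma periodic_nds_equi_uniformly_continuous:
  assumes "periodic_nds k f" "k \<ge> 1" "\<forall>p\<in>{1..k}. uniformly_continuous_on UNIV (f p)" "e > 0"
  shows "\<exists>d>0. \<forall>p\<ge>1. \<forall>x y. dist x y < d \<longrightarrow> dist (f p x) (f p y) < e"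
proof -
  have "\<forall>p\<in>{1..k}. \<exists>d>0. \<forall>x y. dist x y < d \<longrightarrow> dist (f p x) (f p y) < e"
    using assms(3,4) unfolding uniformly_continuous_on_def by (metis UNIV_I)
  then obtain D where D: "\<And>p. p \<in> {1..k} \<Longrightarrow> D p > (0::real)"
      "\<And>p x y. p \<in> {1..k} \<Longrightarrow> dist x y < D p \<Longrightarrow> dist (f p x) (f p y) < e"
    by metis
  define d where "d = Min (D ` {1..k})"
  have "d > 0" using D(1) assms(2) by (simp add: d_def)
  moreover have "dist (f p x) (f p y) < e" if "p \<ge> 1" "dist x y < d" for p x y
  proof -
    \<comment> \<open>The shift by 1 puts the representative of \<open>p\<close> modulo
      \<open>k\<close> into \<open>{1..k}\<close>, avoiding the dummy value
      \<open>f 0\<close>.\<close>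
    define q where "q = 1 + (p - 1) mod k"
    have q: "q \<in> {1..k}" using assms(2) by (simp add: q_def Suc_leI)
    have "p = q + (p - 1) div k * k"
      using that(1) by (simp add: q_def)
    then have "f p = f q"
      using periodic_nds_add_mult[OF assms(1), of q "(p - 1) div k"] q by simp
    moreover have "d \<le> D q" using q by (simp add: d_def)
    ultimately show ?thesis using D(2)[OF q] that(2) by simp
  qed
  ultimately show ?thesis by blast
qed

text \<open>Induction on the maximal length: each further map costs one more use of
  \<open>equi\<close>, whose modulus does not depend on the index, so the starting index
  \<open>i\<close> remains arbitrary.\<close>

lemma nds_iter_equi_uniformly_continuous:
  fixes f :: "nat \<Rightarrow> 'a::metric_space \<Rightarrow> 'a"
  assumes equi: "\<And>e. e > 0 \<Longrightarrow> \<exists>d>0. \<forall>p\<ge>1. \<forall>x y. dist x y < d \<longrightarrow> dist (f p x) (f p y) < e"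
    and "e > 0"
  shows "\<exists>d>0. \<forall>s\<le>N. \<forall>i\<ge>1. \<forall>x y. dist x y < d \<longrightarrow>
           dist (nds_iter f i s x) (nds_iter f i s y) < e"
  using \<open>e > 0\<close>
proof (induction N arbitrary: e)
  case 0
  then show ?case by auto
next
  case (Suc N)
  obtain d1 where d1: "d1 > 0"
    "\<And>p x y. p \<ge> 1 \<Longrightarrow> dist x y < d1 \<Longrightarrow> dist (f p x) (f p y) < e"
    using equi[OF Suc.prems] by blast
  \<comment> \<open>The bound \<open>e\<close> settles lengths up to \<open>N\<close>; the bound
    \<open>d1\<close> allows one more map to be applied.\<close>
  define e' where "e' = min e d1"
  have "e' > 0" using d1(1) Suc.prems by (simp add: e'_def)
  from Suc.IH[OF this] obtain d where d: "d > 0"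
    "\<And>s i x y. s \<le> N \<Longrightarrow> i \<ge> 1 \<Longrightarrow> dist x y < d \<Longrightarrow>
       dist (nds_iter f i s x) (nds_iter f i s y) < e'"
    by blast
  have "dist (nds_iter f i s x) (nds_iter f i s y) < e"
    if "s \<le> Suc N" "i \<ge> 1" "dist x y < d" for s i x y
  proof (cases "s = Suc N")
    case True
    then show ?thesis using d(2)[of N i x y] d1(2)[of "i + N"] that by (simp add: e'_def)
  next
    case False
    then show ?thesis using d(2)[of s i x y] that by (simp add: e'_def)
  qed
  with d(1) show ?case by blast
qed

theorem theorem10:
  fixes f :: "nat \<Rightarrow> 'a::metric_space \<Rightarrow> 'a" and g :: "'a \<Rightarrow> 'a" and k :: nat
  assumes "k \<ge> 1"
    and "periodic_nds k f"
    and "g = nds_iter f 1 k"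
  shows "(Li_Yorke_sensitive (autonomous g) \<longrightarrow> Li_Yorke_sensitive f) \<and>
    ((\<forall>p\<in>{1..k}. uniformly_continuous_on UNIV (f p)) \<and> Li_Yorke_sensitive f
       \<longrightarrow> Li_Yorke_sensitive (autonomous g))"
proof -
  define A where "A x y n = dist (nds_iter f 1 n x) (nds_iter f 1 n y)" for x y n
  define B where "B x y n = dist (nds_iter (autonomous g) 1 n x) (nds_iter (autonomous g) 1 n y)"
    for x y n
  have BA: "B x y m = A x y (m * k)" for x y m
    unfolding A_def B_def nds_iter_autonomous
    using nds_iter_period_mult[OF assms(2), of m] assms(3) by simp
  have mono: "strict_mono (\<lambda>m. m * k)"
    using assms(1) by (simp add: strict_mono_def)
  have comp: "(\<lambda>m. ereal (B x y m)) = (\<lambda>n. ereal (A x y n)) \<circ> (\<lambda>m. m * k)" for x y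
    by (simp add: BA fun_eq_iff)
  have liminf_le: "liminf (\<lambda>n. ereal (A x y n)) \<le> liminf (\<lambda>m. ereal (B x y m))" for x y
    unfolding comp by (rule liminf_subseq_mono[OF mono])
  have limsup_le: "limsup (\<lambda>m. ereal (B x y m)) \<le> limsup (\<lambda>n. ereal (A x y n))" for x y
    unfolding comp by (rule limsup_subseq_mono[OF mono])
  have A_nonneg: "0 \<le> liminf (\<lambda>n. ereal (A x y n))" for x y
    by (rule Liminf_bounded) (simp add: A_def)
  have LYA: "Li_Yorke_sensitive f \<longleftrightarrow> (\<exists>\<delta>>0. \<forall>x. \<forall>\<epsilon>>0. \<exists>y\<in>ball x \<epsilon>.
      liminf (\<lambda>n. ereal (A x y n)) = 0 \<and> limsup (\<lambda>n. ereal (A x y n)) \<ge> ereal \<delta>)"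
    unfolding Li_Yorke_sensitive_def A_def ..
  have LYB: "Li_Yorke_sensitive (autonomous g) \<longleftrightarrow> (\<exists>\<delta>>0. \<forall>x. \<forall>\<epsilon>>0. \<exists>y\<in>ball x \<epsilon>.
      liminf (\<lambda>n. ereal (B x y n)) = 0 \<and> limsup (\<lambda>n. ereal (B x y n)) \<ge> ereal \<delta>)"
    unfolding Li_Yorke_sensitive_def B_def ..
  have transfer: "liminf (\<lambda>n. ereal (A x y n)) = 0 \<and> limsup (\<lambda>n. ereal (A x y n)) \<ge> ereal \<delta>"
    if "liminf (\<lambda>n. ereal (B x y n)) = 0 \<and> limsup (\<lambda>n. ereal (B x y n)) \<ge> ereal \<delta>" for x y \<delta>
    using that A_nonneg[of x y] liminf_le[of x y] limsup_le[of x y] by (auto intro: antisym)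
  have "Li_Yorke_sensitive f" if "Li_Yorke_sensitive (autonomous g)"
    using that transfer unfolding LYA LYB by blast
  moreover have "Li_Yorke_sensitive (autonomous g)"
    if uc: "\<forall>p\<in>{1..k}. uniformly_continuous_on UNIV (f p)" and LY: "Li_Yorke_sensitive f"
  proof -
    \<comment> \<open>The \<open>s\<close> steps after time \<open>n\<close> are
      \<open>nds_iter f (1 + n) s\<close>; uniformity in the starting index makes \<open>d\<close>
      independent of \<open>n\<close>.\<close>
    have equi: "\<exists>d>0. \<forall>n x y. \<forall>s\<le>k. A x y n < d \<longrightarrow> A x y (n + s) < e" if e: "e > 0" for e
    proof -
      obtain d where d: "d > 0" "\<And>s i x y. s \<le> k \<Longrightarrow> i \<ge> 1 \<Longrightarrow> dist x y < d \<Longrightarrow>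
          dist (nds_iter f i s x) (nds_iter f i s y) < e"
        using nds_iter_equi_uniformly_continuous[of f,
            OF periodic_nds_equi_uniformly_continuous[OF assms(2,1) uc] e, of k]
        by blast
      then have "\<forall>n x y. \<forall>s\<le>k. A x y n < d \<longrightarrow> A x y (n + s) < e"
        by (simp add: A_def nds_iter_add)
      with d(1) show ?thesis by blast
    qed
    have liminf_B: "liminf (\<lambda>m. ereal (B x y m)) = 0" if A0: "liminf (\<lambda>n. ereal (A x y n)) = 0" for x y
    proof (rule ccontr)
      assume "\<not> ?thesis"
      then have "0 < liminf (\<lambda>m. ereal (B x y m))"
        using liminf_le[of x y] A0 by simp
      \<comment> \<open>The lower limit may be infinite, so a real number strictly between 0 and it
        is chosen.\<close>
      then obtain e where e: "0 < e" "ereal e < liminf (\<lambda>m. ereal (B x y m))"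
        using ereal_dense2 by (metis ereal_less(2))
      then have ev: "\<forall>\<^sub>F m in sequentially. e < B x y m"
        using less_LiminfD[OF e(2)] by simp
      obtain d where d: "d > 0" "\<And>n s. s \<le> k \<Longrightarrow> A x y n < d \<Longrightarrow> A x y (n + s) < e"
        using equi[OF e(1)] by blast
      obtain M where M: "\<And>m. m \<ge> M \<Longrightarrow> e < B x y m"
        using ev unfolding eventually_sequentially by blast
      have "d \<le> A x y n" if "n \<ge> M * k" for n
      proof (rule ccontr)
        assume "\<not> d \<le> A x y n"
        \<comment> \<open>This is the waiting time until the next multiple of \<open>k\<close> after
          \<open>n\<close>; it is a full \<open>k\<close> if \<open>k\<close> divides
          \<open>n\<close>.\<close>
        moreover have "k - n mod k \<le> k" by simp
        ultimately have "A x y (n + (k - n mod k)) < e" using d(2) by simp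
        moreover have "n + (k - n mod k) = Suc (n div k) * k"
          using div_mult_mod_eq[of n k] mod_less_divisor[of k n] assms(1)
          unfolding mult_Suc by linarith
        moreover have "Suc (n div k) \<ge> M"
          using that assms(1) by (simp add: le_SucI less_eq_div_iff_mult_less_eq)
        ultimately show False using M BA by (metis less_asym)
      qed
      then have "ereal d \<le> liminf (\<lambda>n. ereal (A x y n))"
        by (intro Liminf_bounded) (auto simp: eventually_sequentially)
      with A0 d(1) show False by simp
    qed
    obtain \<delta> where \<delta>: "\<delta> > 0" "\<And>x \<epsilon>. \<epsilon> > 0 \<Longrightarrow> \<exists>y\<in>ball x \<epsilon>.
        liminf (\<lambda>n. ereal (A x y n)) = 0 \<and> limsup (\<lambda>n. ereal (A x y n)) \<ge> ereal \<delta>"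
      using LY unfolding LYA by blast
    \<comment> \<open>This \<open>d\<close> will be the sensitivity constant of \<open>g\<close>.
      Halving \<open>\<delta>\<close> leaves room for the non-strict bound on the upper limit to
      contradict \<open>A\<delta>\<close>.\<close>
    obtain d where d: "d > 0" "\<And>n x y s. s \<le> k \<Longrightarrow> A x y n < d \<Longrightarrow> A x y (n + s) < \<delta> / 2"
      using equi[of "\<delta> / 2"] \<delta>(1) by auto
    have limsup_B: "limsup (\<lambda>m. ereal (B x y m)) \<ge> ereal d"
      if A\<delta>: "limsup (\<lambda>n. ereal (A x y n)) \<ge> ereal \<delta>" for x y
    proof (rule ccontr)
      assume "\<not> ?thesis"
      then have "limsup (\<lambda>m. ereal (B x y m)) < ereal d" by simp
      from Limsup_lessD[OF this] obtain M where M: "\<And>m. m \<ge> M \<Longrightarrow> B x y m < d"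
        by (auto simp: eventually_sequentially)
      have "A x y n \<le> \<delta> / 2" if "n \<ge> M * k" for n
      proof -
        \<comment> \<open>Here the comparison runs forward from the last multiple of
          \<open>k\<close> up to \<open>n\<close>, with \<open>n mod k\<close> steps left.\<close>
        have "n div k \<ge> M"
          using that assms(1) by (simp add: less_eq_div_iff_mult_less_eq)
        then have "A x y (n div k * k) < d" using M BA by metis
        moreover have "n mod k \<le> k" using assms(1) by (simp add: less_imp_le)
        ultimately have "A x y (n div k * k + n mod k) < \<delta> / 2" using d(2) by blast
        then show ?thesis by simp
      qed
      then have "limsup (\<lambda>n. ereal (A x y n)) \<le> ereal (\<delta> / 2)"
        by (intro Limsup_bounded) (auto simp: eventually_sequentially)
      with A\<delta> have "ereal \<delta> \<le> ereal (\<delta> / 2)" by (rule order_trans)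
      with \<delta>(1) show False by simp
    qed
    show ?thesis
      unfolding LYB
    proof (intro exI conjI allI impI)
      fix x and \<epsilon> :: real
      assume "\<epsilon> > 0"
      \<comment> \<open>The point \<open>y\<close> found for \<open>f\<close> also works for
        \<open>g\<close>.\<close>
      from \<delta>(2)[OF this, of x]
      show "\<exists>y\<in>ball x \<epsilon>. liminf (\<lambda>n. ereal (B x y n)) = 0 \<and> limsup (\<lambda>n. ereal (B x y n)) \<ge> ereal d"
        using liminf_B limsup_B by blast
    qed (rule d(1))
  qed
  ultimately show ?thesis by blast
qed

end
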